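(* Let $\alpha>1$ be a real number and, for $x\in(0,1]$, let $(d_i(x))_{i\ge 1}$ denote the digit sequence of the $\alpha$-expansion of $x$. Then \[ \dim_{H}\{x\in(0,1] : \lim_{i\to\infty}d_{i}(x)=\infty\}=0, \] where $\dim_H$ denotes Hausdorff dimension.
   Context: $\mathbb{N}=\{1,2,3,\dots\}$. Let $\alpha>1$ be real. It is known that every $x\in(0,1]$ can be uniquely written in the form \[ x=\sum_{i=1}^{\infty}(\alpha-1)^{i-1}\alpha^{-(d_{1}(x)+\dots+d_{i}(x))} \] with $(d_i(x))_{i\ge1}\in\mathbb{N}^{\mathbb{N}}$, and conversely every sequence in $\mathbb{N}^{\mathbb{N}}$ defines a point of $(0,1]$ in this way. This is called the $\alpha$-expansion of $x$, and the $d_i(x)$ are its digits. *)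

theory Defs
  imports "HOL-Analysis.Analysis"
begin

section \<open>Hausdorff measure and Hausdorff dimension\<close>

text \<open>The contribution \<open>(diam U)\<^sup>s\<close> of one set of a cover, with the usual conventions that the empty
  set contributes \<open>0\<close> and that \<open>0\<^sup>0 = 1\<close> for nonempty sets (in HOL, \<open>0 powr 0 = 0\<close>), so that the
  0-dimensional measure is the counting measure.\<close>

definition diam_pow :: "real \<Rightarrow> 'a::metric_space set \<Rightarrow> ennreal" where
  "diam_pow s U = (if U = {} then 0 else if s = 0 then 1 else ennreal (diameter U powr s))"

text \<open>Boundedness is required explicitly because \<^const>\<open>diameter\<close> is real-valued and unspecified on
  unbounded sets.  Finite covers are included, since members of the sequence may be empty.\<close>

definition hausdorff_premeasure :: "real \<Rightarrow> real \<Rightarrow> 'a::metric_space set \<Rightarrow> ennreal" where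
  "hausdorff_premeasure s \<delta> A =
     (INF U \<in> {U :: nat \<Rightarrow> 'a set. A \<subseteq> (\<Union>n. U n) \<and> (\<forall>n. bounded (U n) \<and> diameter (U n) \<le> \<delta>)}.
        \<Sum>n. diam_pow s (U n))"

definition hausdorff_measure :: "real \<Rightarrow> 'a::metric_space set \<Rightarrow> ennreal" where
  "hausdorff_measure s A = (SUP \<delta>\<in>{0<..}. hausdorff_premeasure s \<delta> A)"

definition hausdorff_dim :: "'a::metric_space set \<Rightarrow> ennreal" where
  "hausdorff_dim A = (INF s\<in>{s. 0 \<le> s \<and> hausdorff_measure s A = 0}. ennreal s)"


section \<open>The \<open>\<alpha>\<close>-expansion\<close>

text \<open>Sequences are indexed from \<open>0\<close>: \<open>d i\<close> is the digit usually written \<open>d\<^sub>i\<^sub>+\<^sub>1\<close>.\<close>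

definition alpha_expansion :: "real \<Rightarrow> (nat \<Rightarrow> nat) \<Rightarrow> real \<Rightarrow> bool" where
  "alpha_expansion \<alpha> d x \<longleftrightarrow>
     (\<forall>i. 1 \<le> d i) \<and> (\<lambda>i. (\<alpha> - 1) ^ i / \<alpha> ^ (\<Sum>j\<le>i. d j)) sums x"

definition alpha_digits :: "real \<Rightarrow> real \<Rightarrow> nat \<Rightarrow> nat" where
  "alpha_digits \<alpha> x = (THE d. alpha_expansion \<alpha> d x)"

text \<open>For \<open>\<alpha> > 1\<close> every digit sequence defines a point of \<open>(0,1]\<close>, and every point of \<open>(0,1]\<close> has
  exactly one expansion, so the definite description above denotes.\<close>

lemma alpha_term_bounds:
  fixes \<alpha> :: real
  assumes "1 < \<alpha>" "\<forall>i. 1 \<le> d i"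
  shows "0 < (\<alpha> - 1) ^ i / \<alpha> ^ (\<Sum>j\<le>i. d j)"
    and "(\<alpha> - 1) ^ i / \<alpha> ^ (\<Sum>j\<le>i. d j) \<le> ((\<alpha> - 1) / \<alpha>) ^ i / \<alpha>"
proof -
  show "0 < (\<alpha> - 1) ^ i / \<alpha> ^ (\<Sum>j\<le>i. d j)"
    using assms by simp
  have "(\<Sum>j\<le>i. 1) \<le> (\<Sum>j\<le>i. d j)"
    using assms(2) by (intro sum_mono) auto
  then have "\<alpha> ^ Suc i \<le> \<alpha> ^ (\<Sum>j\<le>i. d j)"
    using assms(1) by (intro power_increasing) auto
  then have "(\<alpha> - 1) ^ i / \<alpha> ^ (\<Sum>j\<le>i. d j) \<le> (\<alpha> - 1) ^ i / \<alpha> ^ Suc i"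
    using assms(1) by (intro divide_left_mono) auto
  also have "\<dots> = ((\<alpha> - 1) / \<alpha>) ^ i / \<alpha>"
    by (simp add: power_divide)
  finally show "(\<alpha> - 1) ^ i / \<alpha> ^ (\<Sum>j\<le>i. d j) \<le> ((\<alpha> - 1) / \<alpha>) ^ i / \<alpha>" .
qed

lemma alpha_geometric:
  fixes \<alpha> :: real
  assumes "1 < \<alpha>"
  shows "(\<lambda>i. ((\<alpha> - 1) / \<alpha>) ^ i / \<alpha>) sums 1"
proof -
  have "(\<lambda>i. ((\<alpha> - 1) / \<alpha>) ^ i) sums (1 / (1 - (\<alpha> - 1) / \<alpha>))"
    using assms by (intro geometric_sums) (auto simp: divide_simps)
  from sums_divide[OF this, of \<alpha>] show ?thesis
    using assms by (simp add: field_simps)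
qed

lemma alpha_expansion_in_unit:
  assumes "1 < \<alpha>" "alpha_expansion \<alpha> d x"
  shows "x \<in> {0<..1}"
proof -
  have d: "\<forall>i. 1 \<le> d i" and s: "(\<lambda>i. (\<alpha> - 1) ^ i / \<alpha> ^ (\<Sum>j\<le>i. d j)) sums x"
    using assms(2) by (auto simp: alpha_expansion_def)
  note b = alpha_term_bounds[OF assms(1) d]
  have "x \<le> 1"
    by (rule sums_le[OF b(2) s alpha_geometric[OF assms(1)]])
  moreover have "0 < x"
    using suminf_pos[OF sums_summable[OF s] b(1)] sums_unique[OF s] by simp
  ultimately show ?thesis by simp
qed

lemma alpha_expansion_exists:
  assumes "1 < \<alpha>" "\<forall>i. 1 \<le> d i"
  shows "\<exists>x. alpha_expansion \<alpha> d x"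
proof -
  have "summable (\<lambda>i. (\<alpha> - 1) ^ i / \<alpha> ^ (\<Sum>j\<le>i. d j))"
  proof (rule summable_comparison_test')
    show "summable (\<lambda>i. ((\<alpha> - 1) / \<alpha>) ^ i / \<alpha>)"
      using alpha_geometric[OF assms(1)] by (rule sums_summable)
    show "norm ((\<alpha> - 1) ^ i / \<alpha> ^ (\<Sum>j\<le>i. d j)) \<le> ((\<alpha> - 1) / \<alpha>) ^ i / \<alpha>" for i
      using alpha_term_bounds[OF assms, of i] by simp
  qed
  then show ?thesis
    using assms(2) by (auto simp: alpha_expansion_def summable_def)
qed

lemma alpha_expansion_shift:
  assumes "1 < \<alpha>" "alpha_expansion \<alpha> d x"
  obtains y where "alpha_expansion \<alpha> (\<lambda>i. d (Suc i)) y" "x * \<alpha> ^ d 0 = 1 + (\<alpha> - 1) * y"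
proof -
  have d: "\<forall>i. 1 \<le> d i" and s: "(\<lambda>i. (\<alpha> - 1) ^ i / \<alpha> ^ (\<Sum>j\<le>i. d j)) sums x"
    using assms(2) by (auto simp: alpha_expansion_def)
  obtain y where y: "alpha_expansion \<alpha> (\<lambda>i. d (Suc i)) y"
    using alpha_expansion_exists[OF assms(1), of "\<lambda>i. d (Suc i)"] d by auto
  then have "(\<lambda>i. (\<alpha> - 1) ^ i / \<alpha> ^ (\<Sum>j\<le>i. d (Suc j))) sums y"
    by (auto simp: alpha_expansion_def)
  from sums_mult[OF this, of "(\<alpha> - 1) / \<alpha> ^ d 0"]
  have "(\<lambda>i. (\<alpha> - 1) ^ Suc i / \<alpha> ^ (\<Sum>j\<le>Suc i. d j)) sums ((\<alpha> - 1) / \<alpha> ^ d 0 * y)"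
    by (simp add: sum.atMost_Suc_shift power_add del: sum.atMost_Suc)
  then have "(\<lambda>i. (\<alpha> - 1) ^ i / \<alpha> ^ (\<Sum>j\<le>i. d j)) sums ((\<alpha> - 1) / \<alpha> ^ d 0 * y + 1 / \<alpha> ^ d 0)"
    by (subst (asm) sums_Suc_iff) simp
  then have "x = (\<alpha> - 1) / \<alpha> ^ d 0 * y + 1 / \<alpha> ^ d 0"
    using s sums_unique2 by blast
  then have "x * \<alpha> ^ d 0 = 1 + (\<alpha> - 1) * y"
    using assms(1) by (simp add: field_simps)
  with y show ?thesis by (rule that)
qed

lemma alpha_first_digit_unique:
  fixes \<alpha> x :: real
  assumes "1 < \<alpha>" "0 < x" "1 < x * \<alpha> ^ m" "x * \<alpha> ^ m \<le> \<alpha>" "1 < x * \<alpha> ^ n" "x * \<alpha> ^ n \<le> \<alpha>"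
  shows "m = n"
proof -
  have *: False if "a < b" "1 < x * \<alpha> ^ a" "x * \<alpha> ^ b \<le> \<alpha>" for a b
  proof -
    have "\<alpha> ^ Suc a \<le> \<alpha> ^ b"
      using that(1) assms(1) by (intro power_increasing) auto
    then have "\<alpha> * (x * \<alpha> ^ a) \<le> x * \<alpha> ^ b"
      using assms(2) by (simp add: algebra_simps)
    moreover have "\<alpha> * 1 < \<alpha> * (x * \<alpha> ^ a)"
      using that(2) assms(1) by (intro mult_strict_left_mono) auto
    ultimately show False using that(3) by simp
  qed
  show ?thesis using *[of m n] *[of n m] assms by (metis linorder_neqE_nat)
qed

lemma alpha_expansion_first_digit:
  assumes "1 < \<alpha>" "alpha_expansion \<alpha> d x"
  shows "1 < x * \<alpha> ^ d 0" "x * \<alpha> ^ d 0 \<le> \<alpha>"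
proof -
  obtain y where y: "alpha_expansion \<alpha> (\<lambda>i. d (Suc i)) y" "x * \<alpha> ^ d 0 = 1 + (\<alpha> - 1) * y"
    using alpha_expansion_shift[OF assms] .
  have "0 < y" "y \<le> 1"
    using alpha_expansion_in_unit[OF assms(1) y(1)] by auto
  then have "0 < (\<alpha> - 1) * y" "(\<alpha> - 1) * y \<le> \<alpha> - 1"
    using assms(1) by (auto simp: mult_left_le)
  then show "1 < x * \<alpha> ^ d 0" "x * \<alpha> ^ d 0 \<le> \<alpha>"
    unfolding y(2) by linarith+
qed

lemma alpha_expansion_unique:
  assumes "1 < \<alpha>" "alpha_expansion \<alpha> d x" "alpha_expansion \<alpha> e x"
  shows "d = e"
proof
  have first: "d 0 = e 0" if "alpha_expansion \<alpha> d x" "alpha_expansion \<alpha> e x" for d e x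
    using alpha_first_digit_unique[OF assms(1)] alpha_expansion_in_unit[OF assms(1) that(1)]
      alpha_expansion_first_digit[OF assms(1) that(1)]
      alpha_expansion_first_digit[OF assms(1) that(2)] by auto
  show "d i = e i" for i
    using assms(2,3)
  proof (induction i arbitrary: d e x)
    case 0
    then show ?case by (rule first)
  next
    case (Suc i)
    obtain y where y: "alpha_expansion \<alpha> (\<lambda>i. d (Suc i)) y" "x * \<alpha> ^ d 0 = 1 + (\<alpha> - 1) * y"
      using alpha_expansion_shift[OF assms(1) Suc.prems(1)] .
    obtain z where z: "alpha_expansion \<alpha> (\<lambda>i. e (Suc i)) z" "x * \<alpha> ^ e 0 = 1 + (\<alpha> - 1) * z"
      using alpha_expansion_shift[OF assms(1) Suc.prems(2)] .
    have "y = z"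
      using y(2) z(2) first[OF Suc.prems] assms(1) by simp
    then show ?case
      using Suc.IH[OF y(1)] z(1) by simp
  qed
qed

lemma alpha_expansion_ex1:
  assumes \<alpha>: "1 < \<alpha>" and x: "x \<in> {0<..1}"
  shows "\<exists>!d. alpha_expansion \<alpha> d x"
proof -
  have step: "\<exists>k y. 1 \<le> k \<and> y \<in> {0<..1} \<and> u * \<alpha> ^ k = 1 + (\<alpha> - 1) * y"
    if u: "u \<in> {0<..1}" for u :: real
  proof -
    obtain n where n: "1 / u < \<alpha> ^ n"
      using real_arch_pow[OF \<alpha>] by blast
    define k where "k = (LEAST n. 1 < u * \<alpha> ^ n)"
    have k: "1 < u * \<alpha> ^ k"
      unfolding k_def by (rule LeastI[of _ n]) (use n u in \<open>simp add: field_simps\<close>)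
    have "k \<noteq> 0"
      using k u by (intro notI) simp
    then obtain l where l: "k = Suc l"
      using not0_implies_Suc by blast
    have "\<not> 1 < u * \<alpha> ^ l"
      using not_less_Least[of l "\<lambda>n. 1 < u * \<alpha> ^ n"] l by (simp add: k_def)
    then have "\<alpha> * (u * \<alpha> ^ l) \<le> \<alpha> * 1"
      using \<alpha> by (intro mult_left_mono) auto
    then have "u * \<alpha> ^ k \<le> \<alpha>"
      by (simp add: l algebra_simps)
    then show ?thesis
      using k \<open>k \<noteq> 0\<close> \<alpha>
      by (intro exI[of _ k] exI[of _ "(u * \<alpha> ^ k - 1) / (\<alpha> - 1)"]) (auto simp: field_simps)
  qed
  then obtain k T where kT: "\<And>u. u \<in> {0<..1} \<Longrightarrow>
      1 \<le> k u \<and> T u \<in> {0<..1} \<and> u * \<alpha> ^ k u = 1 + (\<alpha> - 1) * (T u :: real)"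
    by metis
  define d where "d i = k ((T ^^ i) x)" for i
  have orbit: "(T ^^ i) x \<in> {0<..1}" for i
    by (induction i) (use x kT in auto)
  have d: "\<forall>i. 1 \<le> d i"
    using kT[OF orbit] by (simp add: d_def)
  have partial: "x = (\<Sum>i<n. (\<alpha> - 1) ^ i / \<alpha> ^ (\<Sum>j\<le>i. d j))
      + (\<alpha> - 1) ^ n / \<alpha> ^ (\<Sum>j<n. d j) * (T ^^ n) x" for n
  proof (induction n)
    case 0
    show ?case by simp
  next
    case (Suc n)
    have "(T ^^ n) x = (1 + (\<alpha> - 1) * (T ^^ Suc n) x) / \<alpha> ^ d n"
      using kT[OF orbit[of n]] \<alpha> by (simp add: d_def field_simps)
    then have "(\<alpha> - 1) ^ n / \<alpha> ^ (\<Sum>j<n. d j) * (T ^^ n) x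
        = (\<alpha> - 1) ^ n / \<alpha> ^ (\<Sum>j<n. d j) * ((1 + (\<alpha> - 1) * (T ^^ Suc n) x) / \<alpha> ^ d n)"
      by simp
    also have "\<dots> = (\<alpha> - 1) ^ n / \<alpha> ^ (\<Sum>j\<le>n. d j)
          + (\<alpha> - 1) ^ Suc n / \<alpha> ^ (\<Sum>j<Suc n. d j) * (T ^^ Suc n) x"
      by (simp add: power_add lessThan_Suc_atMost[symmetric] add_divide_distrib distrib_left
          mult_ac del: funpow.simps)
    finally show ?case
      using Suc.IH by (simp del: funpow.simps)
  qed
  have "(\<lambda>n. \<Sum>i<n. (\<alpha> - 1) ^ i / \<alpha> ^ (\<Sum>j\<le>i. d j)) \<longlonglongrightarrow> x"
  proof -
    have "(\<lambda>n. x - (\<Sum>i<n. (\<alpha> - 1) ^ i / \<alpha> ^ (\<Sum>j\<le>i. d j))) \<longlonglongrightarrow> 0"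
    proof (rule Lim_null_comparison)
      show "(\<lambda>n. ((\<alpha> - 1) / \<alpha>) ^ n) \<longlonglongrightarrow> 0"
        using \<alpha> by (intro LIMSEQ_power_zero) (auto simp: divide_simps)
      have "norm (x - (\<Sum>i<n. (\<alpha> - 1) ^ i / \<alpha> ^ (\<Sum>j\<le>i. d j))) \<le> ((\<alpha> - 1) / \<alpha>) ^ n" for n
      proof -
        have "(\<Sum>j<n. 1) \<le> (\<Sum>j<n. d j)"
          using d by (intro sum_mono) auto
        then have "\<alpha> ^ n \<le> \<alpha> ^ (\<Sum>j<n. d j)"
          using \<alpha> by (intro power_increasing) auto
        then have "(\<alpha> - 1) ^ n / \<alpha> ^ (\<Sum>j<n. d j) \<le> (\<alpha> - 1) ^ n / \<alpha> ^ n"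
          using \<alpha> by (intro divide_left_mono) auto
        moreover have "(\<alpha> - 1) ^ n / \<alpha> ^ (\<Sum>j<n. d j) * (T ^^ n) x
            \<le> (\<alpha> - 1) ^ n / \<alpha> ^ (\<Sum>j<n. d j) * 1"
          using \<alpha> orbit[of n] by (intro mult_left_mono) auto
        moreover have "0 \<le> (\<alpha> - 1) ^ n / \<alpha> ^ (\<Sum>j<n. d j) * (T ^^ n) x"
          using \<alpha> orbit[of n] by (intro mult_nonneg_nonneg) auto
        ultimately show ?thesis
          using partial[of n] by (simp add: power_divide)
      qed
      then show "\<forall>\<^sub>F n in sequentially.
          norm (x - (\<Sum>i<n. (\<alpha> - 1) ^ i / \<alpha> ^ (\<Sum>j\<le>i. d j))) \<le> ((\<alpha> - 1) / \<alpha>) ^ n"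
        by simp
    qed
    from tendsto_diff[OF tendsto_const[of x] this] show ?thesis by simp
  qed
  then have "alpha_expansion \<alpha> d x"
    using d by (simp add: alpha_expansion_def sums_def)
  then show ?thesis
    using alpha_expansion_unique[OF \<alpha>] by blast
qed

lemma alpha_expansion_alpha_digits:
  assumes "1 < \<alpha>" "x \<in> {0<..1}"
  shows "alpha_expansion \<alpha> (alpha_digits \<alpha> x) x"
  unfolding alpha_digits_def using theI'[OF alpha_expansion_ex1[OF assms]] .

end

theory Submission
  imports Defs
begin

text \<open>Fix \<open>s > 0\<close>.  Putting the digit \<open>k\<close> in front of an expansion is the affine map
  \<open>y \<mapsto> (1 + (\<alpha> - 1) y) / \<alpha>\<^sup>k\<close>, which scales lengths by \<open>(\<alpha> - 1) / \<alpha>\<^sup>k\<close>.  The set \<open>E\<close> of points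
  all of whose digits are at least \<open>M\<close> is the union of its own images under these maps for
  \<open>k \<ge> M\<close>, so every countably subadditive set function \<open>h\<close> that scales like the \<open>s\<close>-th power of the
  length satisfies \<open>h(E) \<le> c\<^sub>M h(E)\<close> with \<open>c\<^sub>M = \<Sum>\<^bsub>k\<ge>M\<^esub> ((\<alpha> - 1) / \<alpha>\<^sup>k)\<^sup>s\<close>.
  The series is geometric, hence convergent for every \<open>s > 0\<close>, and its tail \<open>c\<^sub>M\<close> is below \<open>1\<close> when
  \<open>M\<close> is large.  If in addition \<open>h(E)\<close> is finite, then \<open>h(E) = 0\<close>.  Adding finitely many
  unrestricted digits in front only takes countable unions of contracted copies and preserves null sets.
  If the digits of a point tend to infinity, they are eventually at least \<open>M\<close>, so the set in question
  is a countable union of null sets, for each \<open>s > 0\<close>.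

  For \<open>h\<close> one cannot take the Hausdorff measure itself, whose finiteness on \<open>E\<close> is not known in
  advance.  The premeasure at scale \<open>\<delta> = 1\<close> works: it is at most \<open>1\<close> on the unit interval, and
  it has the same null sets as the Hausdorff measure because small \<open>\<Sum> (diam U\<^sub>n)\<^sup>s\<close> forces each
  \<open>diam U\<^sub>n\<close> to be small (\<open>hausdorff_measure_eq_0_if_premeasure_eq_0\<close>).  The argument above is
  \<open>premeasure_large_digits_eq_0\<close>.\<close>

section \<open>The premeasure as an outer measure\<close>

lemma hausdorff_premeasure_le_cover:
  assumes "A \<subseteq> (\<Union>n. U n)" "\<And>n. bounded (U n)" "\<And>n. diameter (U n) \<le> \<delta>"
  shows "hausdorff_premeasure s \<delta> A \<le> (\<Sum>n. diam_pow s (U n))"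
  unfolding hausdorff_premeasure_def using assms by (intro INF_lower) auto

lemma hausdorff_premeasure_less_cover:
  assumes "hausdorff_premeasure s \<delta> A < c"
  obtains U :: "nat \<Rightarrow> 'a::metric_space set"
  where "A \<subseteq> (\<Union>n. U n)" "\<And>n. bounded (U n)" "\<And>n. diameter (U n) \<le> \<delta>"
    "(\<Sum>n. diam_pow s (U n)) < c"
  using assms unfolding hausdorff_premeasure_def INF_less_iff by auto

lemma hausdorff_premeasure_mono:
  assumes "A \<subseteq> B"
  shows "hausdorff_premeasure s \<delta> A \<le> hausdorff_premeasure s \<delta> B"
  unfolding hausdorff_premeasure_def using assms by (intro INF_superset_mono) auto

lemma hausdorff_premeasure_antimono:
  assumes "\<delta> \<le> \<epsilon>"
  shows "hausdorff_premeasure s \<epsilon> A \<le> hausdorff_premeasure s \<delta> A"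
  unfolding hausdorff_premeasure_def using assms by (intro INF_superset_mono Collect_mono) (auto intro: order_trans)

text \<open>The usual outer-measure argument: almost optimal covers of the \<open>A n\<close>, with the error \<open>e\<close>
  distributed as \<open>e / 2\<^sup>n\<^sup>+\<^sup>1\<close>, are merged into one sequence along a bijection between \<open>\<nat> \<times> \<nat>\<close>
  and \<open>\<nat>\<close>.\<close>

lemma hausdorff_premeasure_UN_le:
  fixes A :: "nat \<Rightarrow> 'a::metric_space set"
  shows "hausdorff_premeasure s \<delta> (\<Union>n. A n) \<le> (\<Sum>n. hausdorff_premeasure s \<delta> (A n))"
    (is "?l \<le> (\<Sum>n. ?h n)")
proof (rule ennreal_le_epsilon)
  fix e :: real
  assume fin: "(\<Sum>n. ?h n) < top" and e: "0 < e"
  have "\<exists>U. A n \<subseteq> (\<Union>k. U k) \<and> (\<forall>k. bounded (U k) \<and> diameter (U k) \<le> \<delta>) \<and>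
      (\<Sum>k. diam_pow s (U k)) \<le> ?h n + ennreal (e * (1 / 2) ^ Suc n)" for n
  proof -
    have "?h n < top"
      using fin by (rule ennreal_suminf_lessD)
    then have "?h n < ?h n + ennreal (e * (1 / 2) ^ Suc n)"
      using e by (simp add: ennreal_zero_less_mult_iff)
    then show ?thesis
      by (elim hausdorff_premeasure_less_cover) (metis less_imp_le)
  qed
  then obtain U where U: "\<And>n. A n \<subseteq> (\<Union>k. U n k)"
      "\<And>n k. bounded (U n k)" "\<And>n k. diameter (U n k) \<le> \<delta>"
      "\<And>n. (\<Sum>k. diam_pow s (U n k)) \<le> ?h n + ennreal (e * (1 / 2) ^ Suc n)"
    by metis
  define V where "V p = U (fst p) (snd p)" for p
  have "?l \<le> (\<Sum>i. diam_pow s (V (prod_decode i)))"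
  proof (rule hausdorff_premeasure_le_cover)
    show "(\<Union>n. A n) \<subseteq> (\<Union>i. V (prod_decode i))"
    proof
      fix x assume "x \<in> (\<Union>n. A n)"
      then obtain n k where "x \<in> U n k"
        using U(1) by blast
      then have "x \<in> V (prod_decode (prod_encode (n, k)))"
        by (simp add: V_def)
      then show "x \<in> (\<Union>i. V (prod_decode i))" by blast
    qed
  qed (simp_all add: V_def U)
  also have "\<dots> = (\<Sum>n. \<Sum>k. diam_pow s (U n k))"
    by (rule suminf_ennreal_2dimen[where f = "\<lambda>p. diam_pow s (V p)"]) (simp add: V_def)
  also have "\<dots> \<le> (\<Sum>n. ?h n + ennreal (e * (1 / 2) ^ Suc n))"
    by (intro suminf_le U summableI)
  also have "\<dots> = (\<Sum>n. ?h n) + (\<Sum>n. ennreal (e * (1 / 2) ^ Suc n))"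
    by (intro suminf_add[symmetric] summableI)
  also have "(\<Sum>n. ennreal (e * (1 / 2) ^ Suc n)) = ennreal e"
    using e sums_mult[OF power_half_series, of e] by (intro suminf_ennreal_eq) auto
  finally show "?l \<le> (\<Sum>n. ?h n) + ennreal e" .
qed

lemma diam_pow_image_le:
  fixes f :: "'a::metric_space \<Rightarrow> 'b::metric_space"
  assumes lip: "\<And>x y. dist (f x) (f y) \<le> r * dist x y" and "0 < r" "0 \<le> s" "bounded U"
  shows "bounded (f ` U)" "diameter (f ` U) \<le> r * diameter U"
    "diam_pow s (f ` U) \<le> ennreal (r powr s) * diam_pow s U"
proof -
  have d: "dist (f x) (f y) \<le> r * diameter U" if "x \<in> U" "y \<in> U" for x y
    using lip[of x y] diameter_bounded_bound[OF \<open>bounded U\<close> that] \<open>0 < r\<close>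
    by (smt (verit) mult_left_mono)
  show b: "bounded (f ` U)"
    using d unfolding bounded_two_points by blast
  show le: "diameter (f ` U) \<le> r * diameter U"
  proof (rule ccontr)
    assume "\<not> ?thesis"
    moreover have "0 \<le> r * diameter U"
      using \<open>0 < r\<close> diameter_ge_0[OF \<open>bounded U\<close>] by simp
    ultimately obtain \<eta> where "0 \<le> r * diameter U" "r * diameter U < \<eta>" "\<eta> < diameter (f ` U)"
      using dense by (meson not_le)
    then show False
      using diameter_lower_bounded[OF b, of \<eta>] d by force
  qed
  have "ennreal (diameter (f ` U) powr s) \<le> ennreal (r powr s * diameter U powr s)"
    using le \<open>0 < r\<close> \<open>0 \<le> s\<close> diameter_ge_0[OF b] diameter_ge_0[OF \<open>bounded U\<close>]
    by (simp add: powr_mult[symmetric] powr_mono2 ennreal_leI)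
  then show "diam_pow s (f ` U) \<le> ennreal (r powr s) * diam_pow s U"
    using \<open>0 < r\<close> by (simp add: diam_pow_def ennreal_mult)
qed

lemma hausdorff_premeasure_Lipschitz_image:
  fixes f :: "'a::metric_space \<Rightarrow> 'b::metric_space"
  assumes lip: "\<And>x y. dist (f x) (f y) \<le> r * dist x y" and "0 < r" "0 \<le> s"
  shows "hausdorff_premeasure s (r * \<delta>) (f ` A) \<le> ennreal (r powr s) * hausdorff_premeasure s \<delta> A"
    (is "?l \<le> ?c * ?h")
proof -
  let ?i = "ennreal (1 / r powr s)"
  have inv: "?c * ?i = 1" "?i * ?c = 1"
    using \<open>0 < r\<close> by (simp_all flip: ennreal_mult)
  (* Dividing by the factor first lets the infimum over covers of A be handled as a greatest lower bound. *)
  have "?i * ?l \<le> ?h"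
    unfolding hausdorff_premeasure_def[of s \<delta> A]
  proof (rule INF_greatest, safe)
    fix U :: "nat \<Rightarrow> 'a set"
    assume U: "A \<subseteq> (\<Union>n. U n)" "\<forall>n. bounded (U n) \<and> diameter (U n) \<le> \<delta>"
    note image = diam_pow_image_le[OF lip \<open>0 < r\<close> \<open>0 \<le> s\<close>, of "U _"]
    have "?l \<le> (\<Sum>n. diam_pow s (f ` U n))"
    proof (rule hausdorff_premeasure_le_cover)
      show "f ` A \<subseteq> (\<Union>n. f ` U n)" using U(1) by blast
      show "bounded (f ` U n)" for n using image U(2) by blast
      show "diameter (f ` U n) \<le> r * \<delta>" for n
        using image(2)[of n] U(2) \<open>0 < r\<close> by (meson less_imp_le mult_left_mono order_trans)
    qed
    also have "\<dots> \<le> (\<Sum>n. ?c * diam_pow s (U n))"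
      using image(3) U(2) by (intro suminf_le summableI) auto
    finally have "?l \<le> ?c * (\<Sum>n. diam_pow s (U n))"
      by simp
    then have "?i * ?l \<le> ?i * (?c * (\<Sum>n. diam_pow s (U n)))"
      by (rule mult_left_mono) simp
    then show "?i * ?l \<le> (\<Sum>n. diam_pow s (U n))"
      by (simp add: mult.assoc[symmetric] inv)
  qed
  then have "?c * (?i * ?l) \<le> ?c * ?h"
    by (rule mult_left_mono) simp
  then show ?thesis
    by (simp add: mult.assoc[symmetric] inv)
qed

text \<open>A cover with \<open>\<Sum> (diam U\<^sub>n)\<^sup>s < \<delta>\<^sup>s\<close> consists of sets of diameter below \<open>\<delta>\<close>, so for a null set
  a bound on the size of the covering sets comes for free.\<close>

lemma hausdorff_measure_eq_0_if_premeasure_eq_0: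
  assumes s: "0 < s" and null: "hausdorff_premeasure s \<epsilon> A = 0"
  shows "hausdorff_measure s A = 0"
proof -
  have "hausdorff_premeasure s \<delta> A \<le> 0" if \<delta>: "0 < \<delta>" for \<delta>
  proof (rule ennreal_le_epsilon)
    fix e :: real
    assume "0 < e"
    then have "hausdorff_premeasure s \<epsilon> A < ennreal (min e (\<delta> powr s))"
      using null \<delta> by (simp add: min_def)
    then obtain U where U: "A \<subseteq> (\<Union>n. U n)" "\<And>n. bounded (U n)"
        and small: "(\<Sum>n. diam_pow s (U n)) < ennreal (min e (\<delta> powr s))"
      by (rule hausdorff_premeasure_less_cover) blast
    have "diameter (U n) \<le> \<delta>" for n
    proof (cases "U n = {}")
      case False
      then have "ennreal (diameter (U n) powr s) < ennreal (min e (\<delta> powr s))"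
        using ennreal_suminf_lessD[OF small, of n] s by (simp add: diam_pow_def)
      then have "diameter (U n) powr s < \<delta> powr s"
        by (simp add: ennreal_less_iff)
      then show ?thesis
        using s \<delta> by (meson less_imp_le not_le powr_mono2)
    qed (use \<delta> in simp)
    then have "hausdorff_premeasure s \<delta> A \<le> (\<Sum>n. diam_pow s (U n))"
      using U by (intro hausdorff_premeasure_le_cover)
    also have "\<dots> \<le> ennreal e"
      using small by (meson ennreal_leI less_imp_le min.cobounded1 order_trans)
    finally show "hausdorff_premeasure s \<delta> A \<le> 0 + ennreal e" by simp
  qed
  then show ?thesis
    unfolding hausdorff_measure_def by (auto simp: SUP_eq_const intro!: antisym SUP_least)
qed

section \<open>Points with large digits\<close>

definition large_digits :: "real \<Rightarrow> nat \<Rightarrow> nat \<Rightarrow> real set" where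
  "large_digits \<alpha> M N = {x. \<exists>d. alpha_expansion \<alpha> d x \<and> (\<forall>i\<ge>N. M \<le> d i)}"

definition prepend_digit :: "real \<Rightarrow> nat \<Rightarrow> real \<Rightarrow> real" where
  "prepend_digit \<alpha> k y = (1 + (\<alpha> - 1) * y) / \<alpha> ^ k"

text \<open>The self-similarity behind the proof.  The natural-number difference \<open>N - 1\<close> covers two cases:
  for \<open>N > 0\<close> the constraint moves one place to the left, and for \<open>N = 0\<close> the tail of an expansion
  with all digits at least \<open>M\<close> is again of that kind.\<close>

lemma large_digits_decompose:
  assumes \<alpha>: "1 < \<alpha>" and x: "alpha_expansion \<alpha> d x" "\<forall>i\<ge>N. M \<le> d i"
  shows "x \<in> prepend_digit \<alpha> (d 0) ` large_digits \<alpha> M (N - 1)"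
proof -
  obtain y where y: "alpha_expansion \<alpha> (\<lambda>i. d (Suc i)) y" "x * \<alpha> ^ d 0 = 1 + (\<alpha> - 1) * y"
    using alpha_expansion_shift[OF \<alpha> x(1)] .
  from y(1) x(2) have "y \<in> large_digits \<alpha> M (N - 1)"
    unfolding large_digits_def by (intro CollectI exI[of _ "\<lambda>i. d (Suc i)"]) auto
  moreover have "x = prepend_digit \<alpha> (d 0) y"
    unfolding prepend_digit_def using \<alpha> by (simp add: y(2)[symmetric])
  ultimately show ?thesis by blast
qed

text \<open>The factor \<open>(\<alpha> - 1) / \<alpha>\<^sup>k\<close> is below \<open>1\<close> because \<open>k \<ge> 1\<close>, so the images of sets of diameter at
  most \<open>1\<close> still have diameter at most \<open>1\<close> and the scale need not change.\<close>

lemma premeasure_prepend_digit: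
  assumes \<alpha>: "1 < \<alpha>" and "1 \<le> k" "0 \<le> s"
  shows "hausdorff_premeasure s 1 (prepend_digit \<alpha> k ` A)
    \<le> ennreal (((\<alpha> - 1) / \<alpha> ^ k) powr s) * hausdorff_premeasure s 1 A"
proof -
  let ?r = "(\<alpha> - 1) / \<alpha> ^ k"
  have "\<alpha> ^ 1 \<le> \<alpha> ^ k"
    using assms by (intro power_increasing) auto
  then have r: "0 < ?r" "?r * 1 \<le> 1"
    using \<alpha> by (simp_all add: divide_simps)
  have "dist (prepend_digit \<alpha> k x) (prepend_digit \<alpha> k y) \<le> ?r * dist x y" for x y
  proof -
    have "prepend_digit \<alpha> k x - prepend_digit \<alpha> k y = ?r * (x - y)"
      by (simp add: prepend_digit_def diff_divide_distrib[symmetric] algebra_simps)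
    then show ?thesis
      using r(1) by (simp only: dist_real_def abs_mult abs_of_pos order_refl)
  qed
  from hausdorff_premeasure_Lipschitz_image[OF this r(1) \<open>0 \<le> s\<close>, of 1 A]
    hausdorff_premeasure_antimono[OF r(2)]
  show ?thesis by (rule order_trans[rotated])
qed

lemma contraction_ratios_sum:
  fixes \<alpha> s :: real
  assumes \<alpha>: "1 < \<alpha>" and s: "0 < s"
  shows "(\<lambda>n. ((\<alpha> - 1) / \<alpha> ^ (m + n)) powr s) sums
    (((\<alpha> - 1) / \<alpha> ^ m) powr s / (1 - \<alpha> powr - s))"
proof -
  have eq: "((\<alpha> - 1) / \<alpha> ^ (m + n)) powr s = ((\<alpha> - 1) / \<alpha> ^ m) powr s * (\<alpha> powr - s) ^ n" for n
  proof -
    have "(1 / \<alpha> ^ n) powr s = (\<alpha> powr - s) ^ n"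
    proof -
      have "1 / \<alpha> ^ n = \<alpha> powr - real n"
        using \<alpha> by (simp add: powr_minus_divide powr_realpow)
      then show ?thesis
        using \<alpha> by (simp add: powr_powr powr_power mult.commute)
    qed
    moreover have "((\<alpha> - 1) / \<alpha> ^ (m + n)) powr s = ((\<alpha> - 1) / \<alpha> ^ m) powr s * (1 / \<alpha> ^ n) powr s"
      using \<alpha> by (subst powr_mult[symmetric]) (simp_all add: power_add)
    ultimately show ?thesis by simp
  qed
  have "\<alpha> powr - s < 1"
    using \<alpha> s by (simp add: powr_less_one)
  then show ?thesis
    unfolding eq using sums_mult[OF geometric_sums[of "\<alpha> powr - s"]] by simp
qed

text \<open>The case \<open>N = 0\<close> is the contraction argument: a finite number \<open>h\<close> with \<open>h \<le> c h\<close> and \<open>c < 1\<close> is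
  \<open>0\<close>.  Each further unrestricted digit takes a countable union of images of a null set.\<close>

lemma premeasure_large_digits_eq_0:
  assumes \<alpha>: "1 < \<alpha>" and s: "0 < s"
    and M: "1 \<le> M" "((\<alpha> - 1) / \<alpha> ^ M) powr s / (1 - \<alpha> powr - s) < 1"
  shows "hausdorff_premeasure s 1 (large_digits \<alpha> M N) = 0"
proof (induction N)
  case 0
  let ?E = "large_digits \<alpha> M 0" and ?\<rho> = "\<lambda>n. ((\<alpha> - 1) / \<alpha> ^ (M + n)) powr s"
  let ?h = "hausdorff_premeasure s 1 ?E" and ?c = "((\<alpha> - 1) / \<alpha> ^ M) powr s / (1 - \<alpha> powr - s)"
  have "?E \<subseteq> (\<Union>n. prepend_digit \<alpha> (M + n) ` ?E)"
  proof
    fix x assume "x \<in> ?E"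
    then obtain d where d: "alpha_expansion \<alpha> d x" "\<forall>i\<ge>0. M \<le> d i"
      unfolding large_digits_def by blast
    then have "x \<in> prepend_digit \<alpha> (M + (d 0 - M)) ` ?E"
      using large_digits_decompose[OF \<alpha> d] by simp
    then show "x \<in> (\<Union>n. prepend_digit \<alpha> (M + n) ` ?E)" by blast
  qed
  then have "?h \<le> hausdorff_premeasure s 1 (\<Union>n. prepend_digit \<alpha> (M + n) ` ?E)"
    by (rule hausdorff_premeasure_mono)
  also have "\<dots> \<le> (\<Sum>n. hausdorff_premeasure s 1 (prepend_digit \<alpha> (M + n) ` ?E))"
    by (rule hausdorff_premeasure_UN_le)
  also have "\<dots> \<le> (\<Sum>n. ennreal (?\<rho> n) * ?h)"
    using \<alpha> s M(1) by (intro suminf_le premeasure_prepend_digit summableI) auto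
  also have "\<dots> = (\<Sum>n. ennreal (?\<rho> n)) * ?h"
    by simp
  also have "(\<Sum>n. ennreal (?\<rho> n)) = ennreal ?c"
    by (intro suminf_ennreal_eq contraction_ratios_sum[OF \<alpha> s]) simp
  finally have contract: "?h \<le> ennreal ?c * ?h" .
  (* The inequality excludes only positive finite values; the cover by the unit interval gives finiteness. *)
  have "?h \<le> (\<Sum>n. diam_pow s (if n = 0 then {0..1::real} else {}))"
  proof (rule hausdorff_premeasure_le_cover)
    have "?E \<subseteq> {0..1}"
      using alpha_expansion_in_unit[OF \<alpha>] by (force simp: large_digits_def)
    then show "?E \<subseteq> (\<Union>n::nat. if n = 0 then {0..1} else {})"
      by (auto intro!: exI[of _ 0])
  qed auto
  also have "\<dots> = (\<Sum>n\<in>{0::nat}. diam_pow s (if n = 0 then {0..1::real} else {}))"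
    by (intro suminf_finite) (auto simp: diam_pow_def)
  also have "\<dots> < top"
    by (simp add: diam_pow_def)
  finally obtain t where t: "?h = ennreal t" "0 \<le> t"
    by (cases ?h rule: ennreal_cases) auto
  have c: "0 \<le> ?c"
    using \<alpha> s by (intro divide_nonneg_nonneg) (auto simp: powr_le_one_le powr_less_one less_imp_le)
  have "t \<le> ?c * t"
    using contract t c by (simp only: ennreal_le_iff mult_nonneg_nonneg flip: ennreal_mult)
  with M(2) t(2) have "t = 0"
    by (smt (verit) mult_less_cancel_right2)
  then show ?case using t by simp
next
  case (Suc N)
  have "large_digits \<alpha> M (Suc N) \<subseteq> (\<Union>n. prepend_digit \<alpha> (Suc n) ` large_digits \<alpha> M N)"
  proof
    fix x assume "x \<in> large_digits \<alpha> M (Suc N)"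
    then obtain d where d: "alpha_expansion \<alpha> d x" "\<forall>i\<ge>Suc N. M \<le> d i"
      unfolding large_digits_def by blast
    then have "1 \<le> d 0"
      by (simp add: alpha_expansion_def)
    then have "x \<in> prepend_digit \<alpha> (Suc (d 0 - 1)) ` large_digits \<alpha> M N"
      using large_digits_decompose[OF \<alpha> d] by simp
    then show "x \<in> (\<Union>n. prepend_digit \<alpha> (Suc n) ` large_digits \<alpha> M N)" by blast
  qed
  then have "hausdorff_premeasure s 1 (large_digits \<alpha> M (Suc N))
      \<le> hausdorff_premeasure s 1 (\<Union>n. prepend_digit \<alpha> (Suc n) ` large_digits \<alpha> M N)"
    by (rule hausdorff_premeasure_mono)
  also have "\<dots> \<le> (\<Sum>n. hausdorff_premeasure s 1 (prepend_digit \<alpha> (Suc n) ` large_digits \<alpha> M N))"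
    by (rule hausdorff_premeasure_UN_le)
  also have "\<dots> = 0"
    using premeasure_prepend_digit[OF \<alpha> _ less_imp_le[OF s], of "Suc _" "large_digits \<alpha> M N"]
    by (simp add: Suc.IH)
  finally show ?case by simp
qed

lemma contraction_ratios_sum_small:
  fixes \<alpha> s :: real
  assumes \<alpha>: "1 < \<alpha>" and s: "0 < s"
  obtains M where "1 \<le> M" "((\<alpha> - 1) / \<alpha> ^ M) powr s / (1 - \<alpha> powr - s) < 1"
proof -
  have "(\<lambda>M. (\<alpha> - 1) / \<alpha> ^ M) \<longlonglongrightarrow> 0"
    using \<alpha> by (rule LIMSEQ_divide_realpow_zero)
  then have "(\<lambda>M. ((\<alpha> - 1) / \<alpha> ^ M) powr s) \<longlonglongrightarrow> 0"
    using \<alpha> s by (intro tendsto_zero_powrI[where b = s]) auto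
  then have "(\<lambda>M. ((\<alpha> - 1) / \<alpha> ^ M) powr s / (1 - \<alpha> powr - s)) \<longlonglongrightarrow> 0"
    by (rule tendsto_divide_zero)
  then have "\<forall>\<^sub>F M in sequentially. ((\<alpha> - 1) / \<alpha> ^ M) powr s / (1 - \<alpha> powr - s) < 1"
    by (rule order_tendstoD) simp
  with eventually_ge_at_top[of 1] show ?thesis
    by (metis (mono_tags, lifting) that eventually_conj eventually_happens
        sequentially_bot)
qed

theorem theorem2p1:
  fixes \<alpha> :: real
  assumes "1 < \<alpha>"
  shows "hausdorff_dim {x \<in> {0<..1}. filterlim (\<lambda>i. alpha_digits \<alpha> x i) at_top sequentially} = 0"
proof -
  let ?A = "{x \<in> {0<..1}. filterlim (\<lambda>i. alpha_digits \<alpha> x i) at_top sequentially}"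
  have "hausdorff_dim ?A \<le> 0"
  proof (rule ennreal_le_epsilon)
    fix s :: real
    assume s: "0 < s"
    obtain M where M: "1 \<le> M" "((\<alpha> - 1) / \<alpha> ^ M) powr s / (1 - \<alpha> powr - s) < 1"
      using contraction_ratios_sum_small[OF assms s] .
    have "?A \<subseteq> (\<Union>N. large_digits \<alpha> M N)"
    proof
      fix x assume x: "x \<in> ?A"
      then have "\<forall>\<^sub>F i in sequentially. M \<le> alpha_digits \<alpha> x i"
        by (simp add: filterlim_at_top)
      then obtain N where "\<forall>i\<ge>N. M \<le> alpha_digits \<alpha> x i"
        unfolding eventually_sequentially by blast
      then show "x \<in> (\<Union>N. large_digits \<alpha> M N)"
        unfolding large_digits_def using alpha_expansion_alpha_digits[OF assms, of x] x by blast
    qed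
    then have "hausdorff_premeasure s 1 ?A \<le> hausdorff_premeasure s 1 (\<Union>N. large_digits \<alpha> M N)"
      by (rule hausdorff_premeasure_mono)
    also have "\<dots> \<le> (\<Sum>N. hausdorff_premeasure s 1 (large_digits \<alpha> M N))"
      by (rule hausdorff_premeasure_UN_le)
    also have "\<dots> = 0"
      by (simp add: premeasure_large_digits_eq_0[OF assms s M])
    finally have "hausdorff_measure s ?A = 0"
      using hausdorff_measure_eq_0_if_premeasure_eq_0[OF s] by simp
    then have "hausdorff_dim ?A \<le> ennreal s"
      unfolding hausdorff_dim_def using s by (intro INF_lower) auto
    then show "hausdorff_dim ?A \<le> 0 + ennreal s" by simp
  qed
  then show ?thesis by simp
qed

end
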